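(* Let $(\eta,\omega_1,\omega_2,\omega_3)$ be an $SU(2)$-structure on a $5$-manifold satisfying the Sasaki-Einstein equations $$d\eta=-2\omega_3,\qquad d\omega_1=3\eta\wedge\omega_2,\qquad d\omega_2=-3\eta\wedge\omega_1.$$ Let $(\phi_i,\xi,\eta,g)$, $i\in\{1,2,3\}$, be the associated almost contact metric structures. Then, for $i=1,2$, $(\phi_i,\xi,\eta,g)$ is a nearly cosymplectic structure.
   Context: All manifolds are smooth and connected; $\nabla$ is the Levi-Civita connection of $g$; $d\eta(X,Y)=X(\eta(Y))-Y(\eta(X))-\eta([X,Y])$ and $u\wedge v=u\otimes v-v\otimes u$ for $1$-forms. An almost contact metric structure $(\phi,\xi,\eta,g)$ on $M^{2n+1}$ consists of a $(1,1)$-tensor field $\phi$, a vector field $\xi$, a $1$-form $\eta$ and a Riemannian metric $g$ with $\phi^2=-I+\eta\otimes\xi$, $\eta(\xi)=1$, $g(\phi X,\phi Y)=g(X,Y)-\eta(X)\eta(Y)$. It is nearly cosymplectic if $(\nabla_X\phi)Y+(\nabla_Y\phi)X=0$ for all vector fields $X,Y$. An $SU(2)$-structure on a $5$-manifold is given equivalently by (i) three almost contact metric structures $(\phi_i,\xi,\eta,g)$, $i\in\{1,2,3\}$, with the same $\xi,\eta,g$ and $\phi_i\phi_j=\phi_k=-\phi_j\phi_i$ for every even permutation $(i,j,k)$ of $(1,2,3)$; or (ii) a quadruplet $(\eta,\omega_1,\omega_2,\omega_3)$ of a $1$-form and three $2$-forms with $\omega_i\wedge\omega_j=\delta_{ij}v$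 for some $4$-form $v$ with $v\wedge\eta\neq0$ everywhere, and such that $X\lrcorner\,\omega_1=Y\lrcorner\,\omega_2$ implies $\omega_3(X,Y)\ge0$. The two descriptions are related by $\omega_i(X,Y)=g(\phi_iX,Y)$. *)

theory Defs
  imports "HOL-Analysis.Analysis" "HOL-Library.Function_Algebras"
begin

section \<open>Smooth manifolds\<close>

primrec Ck_on :: "nat \<Rightarrow> ('e::real_normed_vector \<Rightarrow> 'b::real_normed_vector) \<Rightarrow> 'e set \<Rightarrow> bool" where
  "Ck_on 0 f S \<longleftrightarrow> continuous_on S f"
| "Ck_on (Suc k) f S \<longleftrightarrow>
     (\<forall>x\<in>S. f differentiable (at x)) \<and> (\<forall>v. Ck_on k (\<lambda>x. frechet_derivative f (at x) v) S)"

text \<open>Only meaningful for open S, since derivatives are taken in the whole space.\<close>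

definition smooth_on :: "('e::real_normed_vector \<Rightarrow> 'b::real_normed_vector) \<Rightarrow> 'e set \<Rightarrow> bool" where
  "smooth_on f S \<longleftrightarrow> (\<forall>k. Ck_on k f S)"

text \<open>
  The underlying set of the manifold is a whole topological type. An atlas is a set of charts
  \<open>(U, x)\<close>; the values of \<open>x\<close> outside \<open>U\<close> are irrelevant. An atlas need not be maximal: smooth
  functions, hence all notions below, depend only on the maximal atlas it generates.
\<close>

type_synonym ('a, 'n) atlas = "('a set \<times> ('a \<Rightarrow> real ^ 'n)) set"

definition smooth_manifold ::
  "('a::{t2_space, second_countable_topology}, 'n::finite) atlas \<Rightarrow> bool" where
  "smooth_manifold A \<longleftrightarrow>
     (\<Union>(U, x)\<in>A. U) = UNIV \<and>
     (\<forall>(U, x)\<in>A. open U \<and> open (x ` U) \<and> homeomorphism U (x ` U) x (inv_into U x)) \<and>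
     (\<forall>(U, x)\<in>A. \<forall>(V, y)\<in>A. smooth_on (y \<circ> inv_into U x) (x ` (U \<inter> V)))"

definition smooth_funs :: "('a, 'n::finite) atlas \<Rightarrow> ('a \<Rightarrow> real) set" where
  "smooth_funs A = {f. \<forall>(U, x)\<in>A. smooth_on (f \<circ> inv_into U x) (x ` U)}"


section \<open>Tangent vectors and vector fields\<close>

text \<open>
  Tangent vectors at \<open>p\<close> are derivations at \<open>p\<close> of the algebra of smooth functions. Functions which
  are not smooth are sent to 0, so that two tangent vectors are equal iff they agree on smooth
  functions. Sums, differences and 0 of tangent vectors, vector fields and functions are the
  pointwise ones.
\<close>

type_synonym 'a tvec = "('a \<Rightarrow> real) \<Rightarrow> real"
type_synonym 'a vfield = "'a \<Rightarrow> 'a tvec"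

definition tscale :: "real \<Rightarrow> 'a tvec \<Rightarrow> 'a tvec" (infixr "*\<^sub>T" 75) where
  "r *\<^sub>T u = (\<lambda>f. r * u f)"

definition vscale :: "('a \<Rightarrow> real) \<Rightarrow> 'a vfield \<Rightarrow> 'a vfield" (infixr "*\<^sub>V" 75) where
  "h *\<^sub>V X = (\<lambda>p. h p *\<^sub>T X p)"

definition tangent_space :: "('a, 'n::finite) atlas \<Rightarrow> 'a \<Rightarrow> 'a tvec set" where
  "tangent_space A p = {u.
     (\<forall>f. f \<notin> smooth_funs A \<longrightarrow> u f = 0) \<and>
     (\<forall>f\<in>smooth_funs A. \<forall>h\<in>smooth_funs A. \<forall>a b.
        u (\<lambda>q. a * f q + b * h q) = a * u f + b * u h) \<and>
     (\<forall>f\<in>smooth_funs A. \<forall>h\<in>smooth_funs A.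
        u (\<lambda>q. f q * h q) = f p * u h + h p * u f)}"

definition vector_fields :: "('a, 'n::finite) atlas \<Rightarrow> 'a vfield set" where
  "vector_fields A = {X.
     (\<forall>p. X p \<in> tangent_space A p) \<and>
     (\<forall>f\<in>smooth_funs A. (\<lambda>p. X p f) \<in> smooth_funs A)}"

definition lie_bracket :: "'a vfield \<Rightarrow> 'a vfield \<Rightarrow> 'a vfield" where
  "lie_bracket X Y = (\<lambda>p f. X p (\<lambda>q. Y q f) - Y p (\<lambda>q. X q f))"


section \<open>Tensor fields\<close>

text \<open>
  A tensor field is a family of multilinear maps on the tangent spaces (values at arguments which
  are not tangent vectors are irrelevant) which is smooth, i.e. yields a smooth result when
  evaluated on vector fields.
\<close>

type_synonym 'a form1 = "'a \<Rightarrow> 'a tvec \<Rightarrow> real"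
type_synonym 'a form2 = "'a \<Rightarrow> 'a tvec \<Rightarrow> 'a tvec \<Rightarrow> real"
type_synonym 'a form4 = "'a \<Rightarrow> 'a tvec \<Rightarrow> 'a tvec \<Rightarrow> 'a tvec \<Rightarrow> 'a tvec \<Rightarrow> real"
type_synonym 'a endo = "'a \<Rightarrow> 'a tvec \<Rightarrow> 'a tvec"

definition covector :: "('a, 'n::finite) atlas \<Rightarrow> 'a \<Rightarrow> ('a tvec \<Rightarrow> real) \<Rightarrow> bool" where
  "covector A p l \<longleftrightarrow>
     (\<forall>u\<in>tangent_space A p. \<forall>w\<in>tangent_space A p. \<forall>a b.
        l (a *\<^sub>T u + b *\<^sub>T w) = a * l u + b * l w)"

definition one_form :: "('a, 'n::finite) atlas \<Rightarrow> 'a form1 \<Rightarrow> bool" where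
  "one_form A \<alpha> \<longleftrightarrow>
     (\<forall>p. covector A p (\<alpha> p)) \<and>
     (\<forall>X\<in>vector_fields A. (\<lambda>p. \<alpha> p (X p)) \<in> smooth_funs A)"

definition bilinear_field :: "('a, 'n::finite) atlas \<Rightarrow> 'a form2 \<Rightarrow> bool" where
  "bilinear_field A \<beta> \<longleftrightarrow>
     (\<forall>p. \<forall>u\<in>tangent_space A p. covector A p (\<beta> p u) \<and> covector A p (\<lambda>w. \<beta> p w u)) \<and>
     (\<forall>X\<in>vector_fields A. \<forall>Y\<in>vector_fields A. (\<lambda>p. \<beta> p (X p) (Y p)) \<in> smooth_funs A)"

definition two_form :: "('a, 'n::finite) atlas \<Rightarrow> 'a form2 \<Rightarrow> bool" where
  "two_form A \<omega> \<longleftrightarrow>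
     bilinear_field A \<omega> \<and>
     (\<forall>p. \<forall>u\<in>tangent_space A p. \<forall>w\<in>tangent_space A p. \<omega> p u w = - \<omega> p w u)"

text \<open>
  Linearity is required in the first argument only; the antisymmetry under adjacent transpositions
  extends it to the others.
\<close>

definition four_form :: "('a, 'n::finite) atlas \<Rightarrow> 'a form4 \<Rightarrow> bool" where
  "four_form A \<nu> \<longleftrightarrow>
     (\<forall>p. \<forall>s\<in>tangent_space A p. \<forall>t\<in>tangent_space A p.
        \<forall>u\<in>tangent_space A p. \<forall>w\<in>tangent_space A p.
          covector A p (\<lambda>z. \<nu> p z t u w) \<and>
          \<nu> p s t u w = - \<nu> p t s u w \<and>
          \<nu> p s t u w = - \<nu> p s u t w \<and>
          \<nu> p s t u w = - \<nu> p s t w u) \<and>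
     (\<forall>X\<in>vector_fields A. \<forall>Y\<in>vector_fields A. \<forall>Z\<in>vector_fields A. \<forall>W\<in>vector_fields A.
        (\<lambda>p. \<nu> p (X p) (Y p) (Z p) (W p)) \<in> smooth_funs A)"

definition endo_field :: "('a, 'n::finite) atlas \<Rightarrow> 'a endo \<Rightarrow> bool" where
  "endo_field A \<phi> \<longleftrightarrow>
     (\<forall>p. \<forall>u\<in>tangent_space A p. \<phi> p u \<in> tangent_space A p) \<and>
     (\<forall>p. \<forall>u\<in>tangent_space A p. \<forall>w\<in>tangent_space A p. \<forall>a b.
        \<phi> p (a *\<^sub>T u + b *\<^sub>T w) = a *\<^sub>T \<phi> p u + b *\<^sub>T \<phi> p w) \<and>
     (\<forall>X\<in>vector_fields A. (\<lambda>p. \<phi> p (X p)) \<in> vector_fields A)"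

text \<open>
  Wedge products are sums over shuffles, without normalising factor; in degree (1,1) this is the
  convention \<open>u \<and> v = u \<otimes> v - v \<otimes> u\<close>.
\<close>

definition wedge12 :: "'a form1 \<Rightarrow> 'a form2 \<Rightarrow> 'a \<Rightarrow> 'a tvec \<Rightarrow> 'a tvec \<Rightarrow> 'a tvec \<Rightarrow> real" where
  "wedge12 \<alpha> \<beta> p s t u = \<alpha> p s * \<beta> p t u - \<alpha> p t * \<beta> p s u + \<alpha> p u * \<beta> p s t"

definition wedge22 :: "'a form2 \<Rightarrow> 'a form2 \<Rightarrow> 'a form4" where
  "wedge22 \<alpha> \<beta> p s t u w =
     \<alpha> p s t * \<beta> p u w - \<alpha> p s u * \<beta> p t w + \<alpha> p s w * \<beta> p t u
   + \<alpha> p t u * \<beta> p s w - \<alpha> p t w * \<beta> p s u + \<alpha> p u w * \<beta> p s t"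

definition wedge41 :: "'a form4 \<Rightarrow> 'a form1 \<Rightarrow>
    'a \<Rightarrow> 'a tvec \<Rightarrow> 'a tvec \<Rightarrow> 'a tvec \<Rightarrow> 'a tvec \<Rightarrow> 'a tvec \<Rightarrow> real" where
  "wedge41 \<nu> \<alpha> p s t u w z =
     \<nu> p s t u w * \<alpha> p z - \<nu> p s t u z * \<alpha> p w + \<nu> p s t w z * \<alpha> p u
   - \<nu> p s u w z * \<alpha> p t + \<nu> p t u w z * \<alpha> p s"

text \<open>Exterior derivatives of 1- and 2-forms, evaluated on vector fields.\<close>

definition ext_d1 :: "'a form1 \<Rightarrow> 'a vfield \<Rightarrow> 'a vfield \<Rightarrow> 'a \<Rightarrow> real" where
  "ext_d1 \<alpha> X Y p =
     X p (\<lambda>q. \<alpha> q (Y q)) - Y p (\<lambda>q. \<alpha> q (X q)) - \<alpha> p (lie_bracket X Y p)"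

definition ext_d2 :: "'a form2 \<Rightarrow> 'a vfield \<Rightarrow> 'a vfield \<Rightarrow> 'a vfield \<Rightarrow> 'a \<Rightarrow> real" where
  "ext_d2 \<beta> X Y Z p =
     X p (\<lambda>q. \<beta> q (Y q) (Z q)) - Y p (\<lambda>q. \<beta> q (X q) (Z q)) + Z p (\<lambda>q. \<beta> q (X q) (Y q))
   - \<beta> p (lie_bracket X Y p) (Z p) + \<beta> p (lie_bracket X Z p) (Y p)
   - \<beta> p (lie_bracket Y Z p) (X p)"


section \<open>Riemannian metrics and the Levi-Civita connection\<close>

definition riemannian_metric :: "('a, 'n::finite) atlas \<Rightarrow> 'a form2 \<Rightarrow> bool" where
  "riemannian_metric A g \<longleftrightarrow>
     bilinear_field A g \<and>
     (\<forall>p. \<forall>u\<in>tangent_space A p. \<forall>w\<in>tangent_space A p. g p u w = g p w u) \<and>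
     (\<forall>p. \<forall>u\<in>tangent_space A p. u \<noteq> 0 \<longrightarrow> g p u u > 0)"

type_synonym 'a connection = "'a vfield \<Rightarrow> 'a vfield \<Rightarrow> 'a vfield"

definition affine_connection :: "('a, 'n::finite) atlas \<Rightarrow> 'a connection \<Rightarrow> bool" where
  "affine_connection A nabla \<longleftrightarrow>
     (\<forall>X\<in>vector_fields A. \<forall>Y\<in>vector_fields A. nabla X Y \<in> vector_fields A) \<and>
     (\<forall>X\<in>vector_fields A. \<forall>Y\<in>vector_fields A. \<forall>Z\<in>vector_fields A.
        nabla (X + Y) Z = nabla X Z + nabla Y Z \<and>
        nabla X (Y + Z) = nabla X Y + nabla X Z) \<and>
     (\<forall>h\<in>smooth_funs A. \<forall>X\<in>vector_fields A. \<forall>Y\<in>vector_fields A.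
        nabla (h *\<^sub>V X) Y = h *\<^sub>V nabla X Y \<and>
        nabla X (h *\<^sub>V Y) = (\<lambda>p. X p h) *\<^sub>V Y + h *\<^sub>V nabla X Y)"

definition levi_civita :: "('a, 'n::finite) atlas \<Rightarrow> 'a form2 \<Rightarrow> 'a connection \<Rightarrow> bool" where
  "levi_civita A g nabla \<longleftrightarrow>
     affine_connection A nabla \<and>
     (\<forall>X\<in>vector_fields A. \<forall>Y\<in>vector_fields A. nabla X Y - nabla Y X = lie_bracket X Y) \<and>
     (\<forall>X\<in>vector_fields A. \<forall>Y\<in>vector_fields A. \<forall>Z\<in>vector_fields A. \<forall>p.
        X p (\<lambda>q. g q (Y q) (Z q)) = g p (nabla X Y p) (Z p) + g p (Y p) (nabla X Z p))"

definition nabla_endo :: "'a connection \<Rightarrow> 'a vfield \<Rightarrow> 'a endo \<Rightarrow> 'a vfield \<Rightarrow> 'a vfield" where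
  "nabla_endo nabla X \<phi> Y = nabla X (\<lambda>p. \<phi> p (Y p)) - (\<lambda>p. \<phi> p (nabla X Y p))"


section \<open>Almost contact metric structures and SU(2)-structures\<close>

definition almost_contact_metric ::
  "('a, 'n::finite) atlas \<Rightarrow> 'a endo \<Rightarrow> 'a vfield \<Rightarrow> 'a form1 \<Rightarrow> 'a form2 \<Rightarrow> bool" where
  "almost_contact_metric A \<phi> \<xi> \<eta> g \<longleftrightarrow>
     endo_field A \<phi> \<and> \<xi> \<in> vector_fields A \<and> one_form A \<eta> \<and> riemannian_metric A g \<and>
     (\<forall>p. \<forall>u\<in>tangent_space A p. \<phi> p (\<phi> p u) = - u + \<eta> p u *\<^sub>T \<xi> p) \<and>
     (\<forall>p. \<eta> p (\<xi> p) = 1) \<and>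
     (\<forall>p. \<forall>u\<in>tangent_space A p. \<forall>w\<in>tangent_space A p.
        g p (\<phi> p u) (\<phi> p w) = g p u w - \<eta> p u * \<eta> p w)"

definition nearly_cosymplectic ::
  "('a, 'n::finite) atlas \<Rightarrow> 'a connection \<Rightarrow> 'a endo \<Rightarrow> 'a vfield \<Rightarrow> 'a form1 \<Rightarrow> 'a form2 \<Rightarrow> bool"
  where
  "nearly_cosymplectic A nabla \<phi> \<xi> \<eta> g \<longleftrightarrow>
     almost_contact_metric A \<phi> \<xi> \<eta> g \<and> levi_civita A g nabla \<and>
     (\<forall>X\<in>vector_fields A. \<forall>Y\<in>vector_fields A.
        nabla_endo nabla X \<phi> Y + nabla_endo nabla Y \<phi> X = 0)"

text \<open>The two descriptions of an SU(2)-structure; only the indices 1, 2, 3 are used.\<close>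

definition su2_forms ::
  "('a, 5) atlas \<Rightarrow> 'a form1 \<Rightarrow> (nat \<Rightarrow> 'a form2) \<Rightarrow> bool" where
  "su2_forms A \<eta> \<omega> \<longleftrightarrow>
     one_form A \<eta> \<and> (\<forall>i\<in>{1, 2, 3}. two_form A (\<omega> i)) \<and>
     (\<exists>\<nu>. four_form A \<nu> \<and>
        (\<forall>i\<in>{1, 2, 3}. \<forall>j\<in>{1, 2, 3}. \<forall>p. \<forall>s\<in>tangent_space A p. \<forall>t\<in>tangent_space A p.
           \<forall>u\<in>tangent_space A p. \<forall>w\<in>tangent_space A p.
             wedge22 (\<omega> i) (\<omega> j) p s t u w = (if i = j then \<nu> p s t u w else 0)) \<and>
        (\<forall>p. \<exists>s\<in>tangent_space A p. \<exists>t\<in>tangent_space A p. \<exists>u\<in>tangent_space A p.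
           \<exists>w\<in>tangent_space A p. \<exists>z\<in>tangent_space A p. wedge41 \<nu> \<eta> p s t u w z \<noteq> 0)) \<and>
     (\<forall>p. \<forall>u\<in>tangent_space A p. \<forall>w\<in>tangent_space A p.
        (\<forall>z\<in>tangent_space A p. \<omega> 1 p u z = \<omega> 2 p w z) \<longrightarrow> \<omega> 3 p u w \<ge> 0)"

definition su2_acms ::
  "('a, 5) atlas \<Rightarrow> (nat \<Rightarrow> 'a endo) \<Rightarrow> 'a vfield \<Rightarrow> 'a form1 \<Rightarrow> 'a form2 \<Rightarrow> bool" where
  "su2_acms A \<phi> \<xi> \<eta> g \<longleftrightarrow>
     (\<forall>i\<in>{1, 2, 3}. almost_contact_metric A (\<phi> i) \<xi> \<eta> g) \<and>
     (\<forall>(i, j, k)\<in>{(1, 2, 3), (2, 3, 1), (3, 1, 2)}. \<forall>p. \<forall>u\<in>tangent_space A p.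
        \<phi> i p (\<phi> j p u) = \<phi> k p u \<and> \<phi> k p u = - \<phi> j p (\<phi> i p u))"

end

(*
  Write T_i(X, Y, Z) = g((nabla_X phi_i) Y, Z), the covariant derivative of omega_i, and
  B(X, Y) = g(nabla_X xi, Y). The cyclic sum of T_i is d omega_i, and d omega_3 = 0 as
  omega_3 is exact. On the horizontal distribution H = ker eta all three d omega_i vanish, and the
  argument of Hitchin's lemma for hyperkaehler triples gives T_i = 0 there. The equations
  for d omega_i(xi, Y, Z), together with the fact that nabla_xi phi_i anticommutes with phi_i on
  H, force the symmetric part of B to vanish, so B = -omega_3. Hence T_1 = eta /\ omega_2 and
  T_2 = -eta /\ omega_1, which are totally skew.
*)

theory Submission
  imports Defs
begin

section \<open>The vector space of vector fields\<close>

text \<open>H is not integrable: d eta = -2 omega_3 is nondegenerate on it. So Hitchin's lemma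
  cannot be quoted for a four-dimensional leaf; it is redone with the tensors T_i on horizontal
  fields, using only their skewness, their vanishing cyclic sums and the quaternion relations. The
  symmetric part of B vanishes because it changes sign under each of phi_1, phi_2, phi_3, while
  phi_3 = phi_1 phi_2 forces it to be preserved by phi_3. The constants fit together as follows.
  Antisymmetrising the skew form B = -omega_3 doubles it, which is the -2 in d eta. A totally skew
  T_i has cyclic sum 3 T_i, which is the 3 in d omega_i; concretely, T_i(xi, Y, Z) receives 3 from d
  omega_i and -2 from B, leaving the same coefficient as the other slots. The indices 1 and 2 are
  singled out because T_i(X, xi, Z) = -g(phi_3 X, phi_i Z), which is skew in X and Z for i = 1, 2
  but symmetric for i = 3.\<close>

lemma Ck_on_cong:
  assumes "open S" "\<And>x. x \<in> S \<Longrightarrow> f x = h x" "Ck_on k f S"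
  shows "Ck_on k h S"
  using assms(2,3)
proof (induction k arbitrary: f h)
  case 0
  then show ?case by (simp cong: continuous_on_cong)
next
  case (Suc k)
  have D: "(h has_derivative frechet_derivative f (at x)) (at x)" if "x \<in> S" for x
    using Suc.prems that assms(1)
    by (auto intro: has_derivative_transform_within_open[of f] simp: frechet_derivative_works)
  then have "frechet_derivative f (at x) = frechet_derivative h (at x)" if "x \<in> S" for x
    using that frechet_derivative_at by blast
  then have "Ck_on k (\<lambda>x. frechet_derivative h (at x) v) S" for v
    using Suc.IH[of "\<lambda>x. frechet_derivative f (at x) v"] Suc.prems by auto
  moreover have "h differentiable at x" if "x \<in> S" for x
    using D[OF that] by (auto simp: differentiable_def)
  ultimately show ?case by simp
qed

lemma Ck_on_lincomb:
  fixes f h :: "'e::real_normed_vector \<Rightarrow> real"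
  assumes "open S" "Ck_on k f S" "Ck_on k h S"
  shows "Ck_on k (\<lambda>x. a * f x + b * h x) S"
  using assms(2,3)
proof (induction k arbitrary: f h)
  case 0
  then show ?case by (auto intro!: continuous_intros)
next
  case (Suc k)
  have D: "((\<lambda>x. a * f x + b * h x) has_derivative
      (\<lambda>v. a * frechet_derivative f (at x) v + b * frechet_derivative h (at x) v)) (at x)"
    if "x \<in> S" for x
    using Suc.prems that
    by (intro has_derivative_add has_derivative_mult_right)
      (auto simp: frechet_derivative_works)
  have "Ck_on k (\<lambda>x. frechet_derivative (\<lambda>x. a * f x + b * h x) (at x) v) S" for v
  proof (rule Ck_on_cong[OF assms(1)])
    show "Ck_on k (\<lambda>x. a * frechet_derivative f (at x) v + b * frechet_derivative h (at x) v) S"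
      using Suc by auto
    show "a * frechet_derivative f (at x) v + b * frechet_derivative h (at x) v
        = frechet_derivative (\<lambda>x. a * f x + b * h x) (at x) v" if "x \<in> S" for x
      using frechet_derivative_at[OF D[OF that]] by metis
  qed
  then show ?case using D by (auto simp: differentiable_def)
qed

lemma smooth_funs_lincomb:
  assumes "smooth_manifold A" "f \<in> smooth_funs A" "h \<in> smooth_funs A"
  shows "(\<lambda>p. a * f p + b * h p) \<in> smooth_funs A"
  using assms Ck_on_lincomb
  by (fastforce simp: smooth_funs_def smooth_on_def smooth_manifold_def comp_def)

lemma tangent_space_lincomb:
  assumes "u \<in> tangent_space A p" "w \<in> tangent_space A p"
  shows "a *\<^sub>T u + b *\<^sub>T w \<in> tangent_space A p"
  using assms by (simp add: tangent_space_def tscale_def plus_fun_def algebra_simps)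

lemma tangent_space_add:
  "u \<in> tangent_space A p \<Longrightarrow> w \<in> tangent_space A p \<Longrightarrow> u + w \<in> tangent_space A p"
  using tangent_space_lincomb[of u A p w 1 1] by (simp add: tscale_def)

lemma tangent_space_diff:
  "u \<in> tangent_space A p \<Longrightarrow> w \<in> tangent_space A p \<Longrightarrow> u - w \<in> tangent_space A p"
  using tangent_space_lincomb[of u A p w 1 "-1"]
  by (simp add: tscale_def plus_fun_def fun_diff_def)

lemma tangent_space_uminus: "u \<in> tangent_space A p \<Longrightarrow> - u \<in> tangent_space A p"
  using tangent_space_lincomb[of u A p u 0 "-1"]
  by (simp add: tscale_def plus_fun_def fun_Compl_def)

lemma tangent_space_tscale: "u \<in> tangent_space A p \<Longrightarrow> r *\<^sub>T u \<in> tangent_space A p"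
  using tangent_space_lincomb[of u A p u 0 r]
  by (simp add: tscale_def plus_fun_def)

lemmas tangent_space_closed =
  tangent_space_add tangent_space_diff tangent_space_uminus tangent_space_tscale

lemma tangent_lincomb:
  assumes "u \<in> tangent_space A p" "f \<in> smooth_funs A" "h \<in> smooth_funs A"
  shows "u (\<lambda>q. a * f q + b * h q) = a * u f + b * u h"
  using assms by (simp add: tangent_space_def)

lemma tangent_diff:
  assumes "u \<in> tangent_space A p" "f \<in> smooth_funs A" "h \<in> smooth_funs A"
  shows "u (\<lambda>q. f q - h q) = u f - u h"
  using tangent_lincomb[OF assms, of 1 "-1"] by simp

lemma tangent_cmult:
  assumes "u \<in> tangent_space A p" "f \<in> smooth_funs A"
  shows "u (\<lambda>q. r * f q) = r * u f"
  using tangent_lincomb[OF assms assms(2), of r 0] by simp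

lemma tangent_uminus:
  assumes "u \<in> tangent_space A p" "f \<in> smooth_funs A"
  shows "u (\<lambda>q. - f q) = - u f"
  using tangent_cmult[OF assms, of "-1"] by simp

text \<open>The product rule for 1 = 1 * 1 doubles the value, so it vanishes.\<close>

lemma tangent_one:
  assumes "u \<in> tangent_space A p" "(\<lambda>_. 1) \<in> smooth_funs A"
  shows "u (\<lambda>_. 1) = 0"
proof -
  have "u (\<lambda>q. 1 * 1) = 1 * u (\<lambda>_. 1) + 1 * u (\<lambda>_. 1)"
    using assms by (simp only: tangent_space_def mem_Collect_eq)
  then show ?thesis by simp
qed

lemma vector_fields_lincomb:
  assumes "smooth_manifold A" "X \<in> vector_fields A" "Y \<in> vector_fields A"
  shows "(\<lambda>p. a *\<^sub>T X p + b *\<^sub>T Y p) \<in> vector_fields A"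
proof -
  have "(\<lambda>p. a * X p f + b * Y p f) \<in> smooth_funs A" if "f \<in> smooth_funs A" for f
    using assms that by (intro smooth_funs_lincomb) (auto simp: vector_fields_def)
  moreover have "a *\<^sub>T X p + b *\<^sub>T Y p \<in> tangent_space A p" for p
    using assms by (intro tangent_space_lincomb) (auto simp: vector_fields_def)
  ultimately show ?thesis
    unfolding vector_fields_def by (auto simp: tscale_def plus_fun_def)
qed

lemma vector_fields_add:
  assumes "smooth_manifold A" "X \<in> vector_fields A" "Y \<in> vector_fields A"
  shows "X + Y \<in> vector_fields A"
  using vector_fields_lincomb[OF assms, of 1 1] by (simp add: tscale_def plus_fun_def)

lemma vector_fields_diff:
  assumes "smooth_manifold A" "X \<in> vector_fields A" "Y \<in> vector_fields A"
  shows "X - Y \<in> vector_fields A"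
  using vector_fields_lincomb[OF assms, of 1 "-1"]
  by (simp add: tscale_def plus_fun_def fun_diff_def)

lemma vector_fields_uminus:
  assumes "smooth_manifold A" "X \<in> vector_fields A"
  shows "- X \<in> vector_fields A"
  using vector_fields_lincomb[OF assms assms(2), of 0 "-1"]
  by (simp add: tscale_def plus_fun_def fun_Compl_def)

lemma vector_field_tangent: "X \<in> vector_fields A \<Longrightarrow> X p \<in> tangent_space A p"
  by (simp add: vector_fields_def)

lemma vector_field_smooth:
  "X \<in> vector_fields A \<Longrightarrow> f \<in> smooth_funs A \<Longrightarrow> (\<lambda>p. X p f) \<in> smooth_funs A"
  by (simp add: vector_fields_def)

lemma lie_bracket_jacobi:
  assumes "X \<in> vector_fields A" "Y \<in> vector_fields A" "Z \<in> vector_fields A"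
  shows "lie_bracket (lie_bracket X Y) Z p - lie_bracket (lie_bracket X Z) Y p
    + lie_bracket (lie_bracket Y Z) X p = 0"
proof
  fix f
  \<comment> \<open>Additivity of a tangent vector is available on smooth functions only. For f
    outside \<open>smooth_funs A\<close> the default value 0 makes every term vanish, so the Jacobi
    identity holds as an equality of functionals on all real functions.\<close>
  have *: "U p (\<lambda>q. V q (\<lambda>q. W q f) - W q (\<lambda>q. V q f))
      = U p (\<lambda>q. V q (\<lambda>q. W q f)) - U p (\<lambda>q. W q (\<lambda>q. V q f))"
    if "U \<in> vector_fields A" "V \<in> vector_fields A" "W \<in> vector_fields A" for U V W
  proof (cases "f \<in> smooth_funs A")
    case True
    then show ?thesis
      using that by (intro tangent_diff[of _ A p]) (auto intro: vector_field_tangent vector_field_smooth)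
  next
    case False
    then have "V = (\<lambda>q. V q)" "V q f = 0" "W q f = 0" "U q f = 0" for q
      using that by (auto simp: vector_fields_def tangent_space_def)
    then have z: "(\<lambda>q. V q f) = (\<lambda>q. 0)" "(\<lambda>q. W q f) = (\<lambda>q. 0)" by auto
    have zero: "P q (\<lambda>_. 0) = 0" if "P \<in> vector_fields A" for P q
    proof (cases "(\<lambda>_. 0::real) \<in> smooth_funs A")
      case True
      then show ?thesis
        using tangent_cmult[of "P q" A q "\<lambda>_. 0" 0] vector_field_tangent[OF that] by simp
    next
      case False
      then show ?thesis using that by (simp add: vector_fields_def tangent_space_def)
    qed
    show ?thesis using that by (simp add: z zero)
  qed
  show "(lie_bracket (lie_bracket X Y) Z p - lie_bracket (lie_bracket X Z) Y p
    + lie_bracket (lie_bracket Y Z) X p) f = 0 f"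
    using assms by (simp add: lie_bracket_def *)
qed

lemma
  assumes "covector A p l" "u \<in> tangent_space A p"
  shows covector_uminus: "l (- u) = - l u"
    and covector_tscale: "l (r *\<^sub>T u) = r * l u"
    and covector_add: "w \<in> tangent_space A p \<Longrightarrow> l (u + w) = l u + l w"
    and covector_diff: "w \<in> tangent_space A p \<Longrightarrow> l (u - w) = l u - l w"
proof -
  have *: "l (a *\<^sub>T u + b *\<^sub>T w) = a * l u + b * l w" if "w \<in> tangent_space A p" for a b w
    using assms that by (simp add: covector_def)
  show "l (- u) = - l u"
    using *[OF assms(2), of "-1" 0] by (simp add: tscale_def plus_fun_def fun_Compl_def)
  show "l (r *\<^sub>T u) = r * l u"
    using *[OF assms(2), of r 0] by (simp add: tscale_def plus_fun_def)
  assume w: "w \<in> tangent_space A p"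
  show "l (u + w) = l u + l w"
    using *[OF w, of 1 1] by (simp add: tscale_def)
  show "l (u - w) = l u - l w"
    using *[OF w, of 1 "-1"] by (simp add: tscale_def plus_fun_def fun_diff_def)
qed

lemmas covector_linear = covector_uminus covector_tscale covector_add covector_diff

lemma zero_tangent: "0 \<in> tangent_space A p"
  by (simp add: tangent_space_def)

lemma covector_zero: "covector A p l \<Longrightarrow> l 0 = 0"
  using covector_uminus[OF _ zero_tangent, of A p l] by simp

section \<open>SU(2)-structures and their covariant derivatives\<close>

definition I :: "nat set" where "I = {1, 2, 3}"

definition cyc :: "nat \<Rightarrow> nat \<Rightarrow> nat \<Rightarrow> bool" where
  "cyc i j k \<longleftrightarrow> (i, j, k) \<in> {(1, 2, 3), (2, 3, 1), (3, 1, 2)}"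

lemma I_mem [simp]: "1 \<in> I" "Suc 0 \<in> I" "2 \<in> I" "3 \<in> I"
  by (auto simp: I_def)

lemma cyc_I: "cyc i j k \<Longrightarrow> i \<in> I" "cyc i j k \<Longrightarrow> j \<in> I" "cyc i j k \<Longrightarrow> k \<in> I"
  by (auto simp: I_def cyc_def)

locale sasaki_einstein =
  fixes A :: "('a::{t2_space, second_countable_topology}, 5) atlas"
    and \<eta> :: "'a form1" and \<omega> :: "nat \<Rightarrow> 'a form2"
    and \<phi> :: "nat \<Rightarrow> 'a endo" and \<xi> :: "'a vfield" and g :: "'a form2"
    and nabla :: "'a connection"
  assumes mfd: "smooth_manifold A"
    and acms: "su2_acms A \<phi> \<xi> \<eta> g"
    and two_form: "i \<in> I \<Longrightarrow> two_form A (\<omega> i)"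
    and omega: "i \<in> I \<Longrightarrow> u \<in> tangent_space A p \<Longrightarrow> w \<in> tangent_space A p \<Longrightarrow>
      \<omega> i p u w = g p (\<phi> i p u) w"
    and lc: "levi_civita A g nabla"
    and d_eta: "X \<in> vector_fields A \<Longrightarrow> Y \<in> vector_fields A \<Longrightarrow>
      ext_d1 \<eta> X Y p = - 2 * \<omega> 3 p (X p) (Y p)"
    and d_omega1: "X \<in> vector_fields A \<Longrightarrow> Y \<in> vector_fields A \<Longrightarrow> Z \<in> vector_fields A \<Longrightarrow>
      ext_d2 (\<omega> 1) X Y Z p = 3 * wedge12 \<eta> (\<omega> 2) p (X p) (Y p) (Z p)"
    and d_omega2: "X \<in> vector_fields A \<Longrightarrow> Y \<in> vector_fields A \<Longrightarrow> Z \<in> vector_fields A \<Longrightarrow>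
      ext_d2 (\<omega> 2) X Y Z p = - 3 * wedge12 \<eta> (\<omega> 1) p (X p) (Y p) (Z p)"
begin

abbreviation "V \<equiv> vector_fields A"
abbreviation "TM \<equiv> tangent_space A"
abbreviation "ap i X \<equiv> (\<lambda>p. \<phi> i p (X p))"

section \<open>Algebra of the three almost contact metric structures\<close>

lemma acm: "i \<in> I \<Longrightarrow> almost_contact_metric A (\<phi> i) \<xi> \<eta> g"
  using acms by (auto simp: su2_acms_def I_def)

lemma phi_endo: "i \<in> I \<Longrightarrow> endo_field A (\<phi> i)"
  and phi_phi: "i \<in> I \<Longrightarrow> u \<in> TM p \<Longrightarrow> \<phi> i p (\<phi> i p u) = - u + \<eta> p u *\<^sub>T \<xi> p"
  and g_phi_phi: "i \<in> I \<Longrightarrow> u \<in> TM p \<Longrightarrow> w \<in> TM p \<Longrightarrow>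
    g p (\<phi> i p u) (\<phi> i p w) = g p u w - \<eta> p u * \<eta> p w"
  using acm[of i] unfolding almost_contact_metric_def by blast+

lemma xi_field: "\<xi> \<in> V"
  and eta_form: "one_form A \<eta>"
  and metric: "riemannian_metric A g"
  and eta_xi: "\<eta> p (\<xi> p) = 1"
  using acm[OF I_mem(1)] unfolding almost_contact_metric_def by blast+

lemma phi_mult:
  assumes "cyc i j k" "u \<in> TM p"
  shows "\<phi> i p (\<phi> j p u) = \<phi> k p u" "\<phi> j p (\<phi> i p u) = - \<phi> k p u"
proof -
  have *: "\<phi> i p (\<phi> j p u) = \<phi> k p u \<and> \<phi> k p u = - \<phi> j p (\<phi> i p u)"
    using acms assms unfolding su2_acms_def cyc_def by blast
  then show "\<phi> i p (\<phi> j p u) = \<phi> k p u" ..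
  from * have "- \<phi> k p u = - (- \<phi> j p (\<phi> i p u))" by (rule arg_cong[OF conjunct2])
  then show "\<phi> j p (\<phi> i p u) = - \<phi> k p u" by simp
qed

lemma connection: "affine_connection A nabla"
  using lc by (simp add: levi_civita_def)

lemma field_tangent [simp]: "X \<in> V \<Longrightarrow> X p \<in> TM p"
  by (rule vector_field_tangent)

lemma xi_tangent [simp]: "\<xi> p \<in> TM p"
  using field_tangent[OF xi_field] .

lemma phi_tangent [simp]: "i \<in> I \<Longrightarrow> u \<in> TM p \<Longrightarrow> \<phi> i p u \<in> TM p"
  using phi_endo[of i] by (simp add: endo_field_def)

lemma phi_field [simp]: "i \<in> I \<Longrightarrow> X \<in> V \<Longrightarrow> ap i X \<in> V"
  using phi_endo[of i] by (simp add: endo_field_def)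

lemma nabla_field [simp]: "X \<in> V \<Longrightarrow> Y \<in> V \<Longrightarrow> nabla X Y \<in> V"
  using connection by (simp add: affine_connection_def)

lemmas field_closed [simp] =
  vector_fields_add[OF mfd] vector_fields_diff[OF mfd] vector_fields_uminus[OF mfd] xi_field

declare tangent_space_closed [simp]

lemma bilinear_g: "bilinear_field A g"
  using metric unfolding riemannian_metric_def by blast

lemma g_sym: "u \<in> TM p \<Longrightarrow> w \<in> TM p \<Longrightarrow> g p u w = g p w u"
  using metric unfolding riemannian_metric_def by blast

lemma g_nondegenerate:
  assumes "u \<in> TM p" "g p u u = 0"
  shows "u = 0"
  using metric assms unfolding riemannian_metric_def by (metis less_irrefl)

lemma g_covector: "u \<in> TM p \<Longrightarrow> covector A p (g p u)"
  "u \<in> TM p \<Longrightarrow> covector A p (\<lambda>w. g p w u)"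
  using bilinear_g unfolding bilinear_field_def by blast+

lemma g_linear_right:
  assumes "u \<in> TM p" "z \<in> TM p"
  shows "g p z (- u) = - g p z u" "g p z (r *\<^sub>T u) = r * g p z u"
    "w \<in> TM p \<Longrightarrow> g p z (u + w) = g p z u + g p z w"
    "w \<in> TM p \<Longrightarrow> g p z (u - w) = g p z u - g p z w"
  using covector_linear[OF g_covector(1)[OF assms(2)] assms(1)] by blast+

lemma g_linear_left:
  assumes "u \<in> TM p" "z \<in> TM p"
  shows "g p (- u) z = - g p u z" "g p (r *\<^sub>T u) z = r * g p u z"
    "w \<in> TM p \<Longrightarrow> g p (u + w) z = g p u z + g p w z"
    "w \<in> TM p \<Longrightarrow> g p (u - w) z = g p u z - g p w z"
  using covector_linear[OF g_covector(2)[OF assms(2)] assms(1)] by blast+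

lemma g_zero: "u \<in> TM p \<Longrightarrow> g p 0 u = 0" "u \<in> TM p \<Longrightarrow> g p u 0 = 0"
  by (fact covector_zero[OF g_covector(2)], fact covector_zero[OF g_covector(1)])

lemmas g_linear = g_linear_left g_linear_right g_zero

lemma eta_linear:
  assumes "u \<in> TM p"
  shows "\<eta> p (- u) = - \<eta> p u" "\<eta> p (r *\<^sub>T u) = r * \<eta> p u"
    "w \<in> TM p \<Longrightarrow> \<eta> p (u + w) = \<eta> p u + \<eta> p w"
    "w \<in> TM p \<Longrightarrow> \<eta> p (u - w) = \<eta> p u - \<eta> p w"
proof -
  have "covector A p (\<eta> p)" using eta_form unfolding one_form_def by blast
  from covector_linear[OF this assms] show "\<eta> p (- u) = - \<eta> p u" "\<eta> p (r *\<^sub>T u) = r * \<eta> p u"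
    "w \<in> TM p \<Longrightarrow> \<eta> p (u + w) = \<eta> p u + \<eta> p w"
    "w \<in> TM p \<Longrightarrow> \<eta> p (u - w) = \<eta> p u - \<eta> p w" by blast+
qed

lemma phi_linear:
  assumes "i \<in> I" "u \<in> TM p"
  shows "\<phi> i p (- u) = - \<phi> i p u" "\<phi> i p (r *\<^sub>T u) = r *\<^sub>T \<phi> i p u"
    "w \<in> TM p \<Longrightarrow> \<phi> i p (u + w) = \<phi> i p u + \<phi> i p w"
    "w \<in> TM p \<Longrightarrow> \<phi> i p (u - w) = \<phi> i p u - \<phi> i p w"
proof -
  have *: "\<phi> i p (a *\<^sub>T u + b *\<^sub>T w) = a *\<^sub>T \<phi> i p u + b *\<^sub>T \<phi> i p w" if "w \<in> TM p" for a b w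
    using phi_endo[OF assms(1)] assms(2) that unfolding endo_field_def by blast
  show "\<phi> i p (- u) = - \<phi> i p u"
    using *[OF assms(2), of "-1" 0] by (simp add: tscale_def plus_fun_def fun_Compl_def)
  show "\<phi> i p (r *\<^sub>T u) = r *\<^sub>T \<phi> i p u"
    using *[OF assms(2), of r 0] by (simp add: tscale_def plus_fun_def)
  show "\<phi> i p (u + w) = \<phi> i p u + \<phi> i p w" if "w \<in> TM p"
    using *[OF that, of 1 1] by (simp add: tscale_def)
  show "\<phi> i p (u - w) = \<phi> i p u - \<phi> i p w" if "w \<in> TM p"
    using *[OF that, of 1 "-1"] by (simp add: tscale_def plus_fun_def fun_diff_def)
qed

lemma g_phi_skew:
  assumes "i \<in> I" "u \<in> TM p" "w \<in> TM p"
  shows "g p (\<phi> i p u) w = - g p (\<phi> i p w) u"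
proof -
  have "\<omega> i p u w = - \<omega> i p w u"
    using two_form[OF assms(1)] assms(2,3) unfolding two_form_def by blast
  then show ?thesis
    using assms by (simp add: omega)
qed

lemma g_phi:
  assumes "i \<in> I" "u \<in> TM p" "w \<in> TM p"
  shows "g p (\<phi> i p u) w = - g p u (\<phi> i p w)"
  using g_phi_skew[OF assms] g_sym[of "\<phi> i p w" p u] assms by simp

text \<open>phi_i squared kills xi, and by skewness the squared length of phi_i xi is -g(xi,
  phi_i(phi_i xi)).\<close>

lemma phi_xi:
  assumes "i \<in> I"
  shows "\<phi> i p (\<xi> p) = 0"
proof (rule g_nondegenerate)
  have "\<phi> i p (\<phi> i p (\<xi> p)) = 0"
    using phi_phi[OF assms, of "\<xi> p" p] by (simp add: eta_xi tscale_def)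
  then show "g p (\<phi> i p (\<xi> p)) (\<phi> i p (\<xi> p)) = 0"
    using g_phi[OF assms, of "\<xi> p" p "\<phi> i p (\<xi> p)"] assms
    by (simp add: g_zero)
qed (use assms in simp)

text \<open>This is the compatibility of g with phi_1 evaluated at w = xi, where phi_1 xi =
  0.\<close>

lemma eta_g: "u \<in> TM p \<Longrightarrow> \<eta> p u = g p u (\<xi> p)"
  using g_phi_phi[of 1 u p "\<xi> p"] by (simp add: phi_xi eta_xi g_zero)

lemma eta_phi:
  assumes "i \<in> I" "u \<in> TM p"
  shows "\<eta> p (\<phi> i p u) = 0"
  using g_phi[OF assms xi_tangent] eta_g[OF phi_tangent[OF assms]] g_zero(2)[OF assms(2)]
  by (simp add: phi_xi[OF assms(1)])

lemma smooth_g: "X \<in> V \<Longrightarrow> Y \<in> V \<Longrightarrow> (\<lambda>p. g p (X p) (Y p)) \<in> smooth_funs A"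
  using bilinear_g unfolding bilinear_field_def by blast

lemma smooth_g_phi:
  "i \<in> I \<Longrightarrow> X \<in> V \<Longrightarrow> Y \<in> V \<Longrightarrow> (\<lambda>p. g p (\<phi> i p (X p)) (Y p)) \<in> smooth_funs A"
  by (rule smooth_g[OF phi_field])

lemma smooth_eta: "X \<in> V \<Longrightarrow> (\<lambda>p. \<eta> p (X p)) \<in> smooth_funs A"
  using eta_form unfolding one_form_def by blast

lemma compat:
  "X \<in> V \<Longrightarrow> Y \<in> V \<Longrightarrow> Z \<in> V \<Longrightarrow>
    X p (\<lambda>q. g q (Y q) (Z q)) = g p (nabla X Y p) (Z p) + g p (Y p) (nabla X Z p)"
  using lc unfolding levi_civita_def by blast

lemma torsion_free: "X \<in> V \<Longrightarrow> Y \<in> V \<Longrightarrow> lie_bracket X Y = nabla X Y - nabla Y X"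
  using lc unfolding levi_civita_def by metis

lemma bracket_field [simp]: "X \<in> V \<Longrightarrow> Y \<in> V \<Longrightarrow> lie_bracket X Y \<in> V"
  by (simp add: torsion_free)

lemma nabla_add_left:
  "X \<in> V \<Longrightarrow> Y \<in> V \<Longrightarrow> Z \<in> V \<Longrightarrow> nabla (X + Y) Z = nabla X Z + nabla Y Z"
  and nabla_add_right:
  "X \<in> V \<Longrightarrow> Y \<in> V \<Longrightarrow> Z \<in> V \<Longrightarrow> nabla X (Y + Z) = nabla X Y + nabla X Z"
  and nabla_vscale:
  "h \<in> smooth_funs A \<Longrightarrow> X \<in> V \<Longrightarrow> Y \<in> V \<Longrightarrow> nabla (h *\<^sub>V X) Y = h *\<^sub>V nabla X Y"
  using connection unfolding affine_connection_def by blast+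

lemma nabla_zero:
  assumes "X \<in> V"
  shows "nabla X 0 = 0" "nabla 0 X = 0"
proof -
  have "0 \<in> V" using field_closed(2)[of X X] assms by simp
  from nabla_add_right[OF assms this this] nabla_add_left[OF this this assms]
  show "nabla X 0 = 0" "nabla 0 X = 0" by auto
qed

lemma nabla_uminus:
  assumes "X \<in> V" "Y \<in> V"
  shows "nabla X (- Y) = - nabla X Y" "nabla (- Y) X = - nabla Y X"
  using nabla_add_right[of X Y "- Y"] nabla_add_left[of Y "- Y" X] assms
  by (simp_all add: nabla_zero eq_neg_iff_add_eq_0 add.commute)

section \<open>Covariant derivatives of xi and of the omega_i\<close>

definition B :: "'a vfield \<Rightarrow> 'a vfield \<Rightarrow> 'a \<Rightarrow> real" where
  "B X Y p = g p (nabla X \<xi> p) (Y p)"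

definition T :: "nat \<Rightarrow> 'a vfield \<Rightarrow> 'a vfield \<Rightarrow> 'a vfield \<Rightarrow> 'a \<Rightarrow> real" where
  "T i X Y Z p = g p (nabla_endo nabla X (\<phi> i) Y p) (Z p)"

lemma nabla_endo_field [simp]:
  "i \<in> I \<Longrightarrow> X \<in> V \<Longrightarrow> Y \<in> V \<Longrightarrow> nabla_endo nabla X (\<phi> i) Y \<in> V"
  by (simp add: nabla_endo_def)

lemma T_eq:
  assumes "i \<in> I" "X \<in> V" "Y \<in> V" "Z \<in> V"
  shows "T i X Y Z p = g p (nabla X (ap i Y) p) (Z p) - g p (\<phi> i p (nabla X Y p)) (Z p)"
  using assms by (simp add: T_def nabla_endo_def g_linear)

lemma T_eq_omega:
  assumes "i \<in> I" "X \<in> V" "Y \<in> V" "Z \<in> V"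
  shows "T i X Y Z p = X p (\<lambda>q. g q (\<phi> i q (Y q)) (Z q))
    - g p (\<phi> i p (Y p)) (nabla X Z p) - g p (\<phi> i p (nabla X Y p)) (Z p)"
  using compat[OF assms(2) phi_field[OF assms(1,3)] assms(4), of p] T_eq[OF assms] by simp

lemma T_skew:
  assumes "i \<in> I" "X \<in> V" "Y \<in> V" "Z \<in> V"
  shows "T i X Z Y p = - T i X Y Z p"
proof -
  have "(\<lambda>q. g q (\<phi> i q (Z q)) (Y q)) = (\<lambda>q. - g q (\<phi> i q (Y q)) (Z q))"
    by (rule ext, rule g_phi_skew) (use assms in simp_all)
  then have "X p (\<lambda>q. g q (\<phi> i q (Z q)) (Y q)) = - X p (\<lambda>q. g q (\<phi> i q (Y q)) (Z q))"
    using tangent_uminus[OF field_tangent[OF assms(2)] smooth_g_phi[OF assms(1,3,4)]] by simp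
  then show ?thesis
    using g_phi_skew[OF assms(1), of "Z p" p "nabla X Y p"]
      g_phi_skew[OF assms(1), of "Y p" p "nabla X Z p"]
      T_eq_omega[OF assms] T_eq_omega[OF assms(1,2,4,3)] assms
    by simp
qed

lemma T_cyclic:
  assumes "i \<in> I" "X \<in> V" "Y \<in> V" "Z \<in> V"
  shows "T i X Y Z p + T i Y Z X p + T i Z X Y p = ext_d2 (\<omega> i) X Y Z p"
proof -
  have sk: "\<omega> i q u w = - \<omega> i q w u" if "u \<in> TM q" "w \<in> TM q" for q u w
    using two_form[OF assms(1)] that unfolding two_form_def by blast
  have sm: "(\<lambda>q. \<omega> i q (Y q) (Z q)) \<in> smooth_funs A" if "Y \<in> V" "Z \<in> V" for Y Z
    using two_form[OF assms(1)] that unfolding two_form_def bilinear_field_def by blast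
  have T: "T i X Y Z p = X p (\<lambda>q. \<omega> i q (Y q) (Z q)) - \<omega> i p (Y p) (nabla X Z p)
      - \<omega> i p (nabla X Y p) (Z p)" if "X \<in> V" "Y \<in> V" "Z \<in> V" for X Y Z
    using assms(1) that by (simp add: T_eq_omega omega)
  have "(\<lambda>q. \<omega> i q (Z q) (X q)) = (\<lambda>q. - \<omega> i q (X q) (Z q))"
    by (rule ext, rule sk) (use assms in simp_all)
  then have "Y p (\<lambda>q. \<omega> i q (Z q) (X q)) = - Y p (\<lambda>q. \<omega> i q (X q) (Z q))"
    using tangent_uminus[OF field_tangent[OF assms(3)] sm[OF assms(2,4)]] by simp
  moreover have lin: "\<omega> i p (lie_bracket X Y p) (Z p)
      = \<omega> i p (nabla X Y p) (Z p) - \<omega> i p (nabla Y X p) (Z p)" if "X \<in> V" "Y \<in> V" "Z \<in> V" for X Y Z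
    using assms(1) that by (simp add: omega torsion_free phi_linear g_linear)
  ultimately show ?thesis
    using assms sk[of "Y p" p "nabla X Z p"] sk[of "Z p" p "nabla Y X p"] sk[of "X p" p "nabla Z Y p"]
    by (simp add: ext_d2_def T lin)
qed

text \<open>Since phi_i xi = 0, only -phi_i(nabla_X xi) survives in (nabla_X phi_i) xi, and skewness
  moves phi_i over to Z.\<close>

lemma T_xi:
  assumes "i \<in> I" "X \<in> V" "Z \<in> V"
  shows "T i X \<xi> Z p = B X (ap i Z) p"
proof -
  have "ap i \<xi> = 0" using phi_xi[OF assms(1)] by auto
  then have "nabla X (ap i \<xi>) p = 0" using nabla_zero(1)[OF assms(2)] by simp
  then show ?thesis
    using assms by (simp add: T_eq B_def g_zero g_phi)
qed

text \<open>Product rule for phi_k = phi_i phi_j, and for -phi_k = phi_j phi_i. The outer factor is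
  moved to Z by skewness, whence the minus sign before the second term.\<close>

lemma T_mult:
  assumes "cyc i j k" "X \<in> V" "Y \<in> V" "Z \<in> V"
  shows "T i X (ap j Y) Z p - T j X Y (ap i Z) p = T k X Y Z p"
    and "T j X (ap i Y) Z p - T i X Y (ap j Z) p = - T k X Y Z p"
proof -
  have ijk: "i \<in> I" "j \<in> I" "k \<in> I" using cyc_I[OF assms(1)] by auto
  have m: "\<phi> i q (\<phi> j q u) = \<phi> k q u" "\<phi> j q (\<phi> i q u) = - \<phi> k q u" if "u \<in> TM q" for q u
    using phi_mult[OF assms(1) that] .
  have "(\<lambda>q. - \<phi> k q (Y q)) = - ap k Y" by auto
  then have n: "nabla X (\<lambda>q. - \<phi> k q (Y q)) p = - nabla X (ap k Y) p"
    using nabla_uminus(1)[of X "ap k Y"] ijk assms by simp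
  show "T i X (ap j Y) Z p - T j X Y (ap i Z) p = T k X Y Z p"
    using ijk assms(2-) m g_phi[OF ijk(1), of "nabla X (ap j Y) p" p "Z p"]
      g_phi[OF ijk(1), of "\<phi> j p (nabla X Y p)" p "Z p"]
    by (simp add: T_eq)
  show "T j X (ap i Y) Z p - T i X Y (ap j Z) p = - T k X Y Z p"
    using ijk assms(2-) m n g_phi[OF ijk(2), of "nabla X (ap i Y) p" p "Z p"]
      g_phi[OF ijk(2), of "\<phi> i p (nabla X Y p)" p "Z p"]
    by (simp add: T_eq g_linear)
qed

section \<open>Horizontal fields and splitting off the xi-component\<close>

definition H :: "'a vfield set" where
  "H = {X \<in> V. \<forall>p. \<eta> p (X p) = 0}"

lemma H_D: "X \<in> H \<Longrightarrow> X \<in> V" "X \<in> H \<Longrightarrow> \<eta> p (X p) = 0"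
  by (auto simp: H_def)

lemma phi_H: "i \<in> I \<Longrightarrow> X \<in> V \<Longrightarrow> ap i X \<in> H"
  by (simp add: H_def eta_phi)

lemma phi_phi_H: "i \<in> I \<Longrightarrow> X \<in> H \<Longrightarrow> ap i (ap i X) = - X"
  by (auto simp: H_def phi_phi tscale_def fun_eq_iff)

lemma T_uminus:
  assumes "i \<in> I" "X \<in> V" "Y \<in> V" "Z \<in> V"
  shows "T i (- X) Y Z p = - T i X Y Z p" "T i X (- Y) Z p = - T i X Y Z p"
    "T i X Y (- Z) p = - T i X Y Z p"
proof -
  have *: "T i X Y (- Z) p = - T i X Y Z p" if "Y \<in> V" "Z \<in> V" for Y Z
    using assms that by (simp add: T_def g_linear)
  show "T i X (- Y) Z p = - T i X Y Z p"
    using *[of Z Y] assms T_skew[of i X Z "- Y" p] T_skew[of i X Y Z p] by simp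
  show "T i X Y (- Z) p = - T i X Y Z p"
    using * assms by simp
  show "T i (- X) Y Z p = - T i X Y Z p"
    using assms by (simp add: T_eq nabla_uminus phi_linear g_linear)
qed

text \<open>Derivative of phi_i^2 = -1 on H. The correction eta(nabla_X Y) xi, present because
  nabla_X Y need not be horizontal, is orthogonal to Z.\<close>

lemma T_phi:
  assumes "i \<in> I" "X \<in> V" "Y \<in> H" "Z \<in> H"
  shows "T i X (ap i Y) Z p = T i X Y (ap i Z) p"
proof -
  note V = H_D(1)[OF assms(3)] H_D(1)[OF assms(4)]
  have "nabla X (ap i (ap i Y)) p = - nabla X Y p"
    using assms V nabla_uminus(1)[of X Y] by (simp add: phi_phi_H)
  moreover have "g p (\<xi> p) (Z p) = 0"
    using H_D(2)[OF assms(4), of p] V by (simp add: eta_g g_sym)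
  ultimately show ?thesis
    using assms(1,2) V g_phi[OF assms(1), of "nabla X (ap i Y) p" p "Z p"]
      g_phi[OF assms(1), of "\<phi> i p (nabla X Y p)" p "Z p"]
    by (simp add: T_eq g_linear phi_phi)
qed

text \<open>The instances of tensoriality needed to split a field into its horizontal part and a
  multiple of xi. Linearity in the second slot is read off from the third through
  \<open>T_skew\<close>, in place of cancelling Leibniz terms.\<close>

lemma T_add:
  assumes "i \<in> I" "X \<in> V" "Y \<in> V" "Z \<in> V" "f \<in> smooth_funs A" "f *\<^sub>V \<xi> \<in> V"
  shows "T i (X + f *\<^sub>V \<xi>) Y Z p = T i X Y Z p + f p * T i \<xi> Y Z p"
    and "T i X Y (Z + f *\<^sub>V \<xi>) p = T i X Y Z p + f p * T i X Y \<xi> p"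
    and "T i X (Y + f *\<^sub>V \<xi>) Z p = T i X Y Z p + f p * T i X \<xi> Z p"
proof -
  have n: "nabla (X + f *\<^sub>V \<xi>) W p = nabla X W p + f p *\<^sub>T nabla \<xi> W p" if "W \<in> V" for W
    using nabla_add_left[OF assms(2,6) that] nabla_vscale[OF assms(5) xi_field that]
    by (simp add: vscale_def)
  have "\<phi> i p (f p *\<^sub>T nabla \<xi> Y p) = f p *\<^sub>T \<phi> i p (nabla \<xi> Y p)"
    using assms by (simp add: phi_linear)
  then show "T i (X + f *\<^sub>V \<xi>) Y Z p = T i X Y Z p + f p * T i \<xi> Y Z p"
    using assms by (simp add: T_eq n phi_linear g_linear algebra_simps)
  have r: "T i X Y (Z + f *\<^sub>V \<xi>) p = T i X Y Z p + f p * T i X Y \<xi> p" if "Y \<in> V" "Z \<in> V" for Y Z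
  proof -
    have "(Z + f *\<^sub>V \<xi>) p = Z p + f p *\<^sub>T \<xi> p"
      by (simp add: vscale_def)
    then show ?thesis using that assms by (simp add: T_def g_linear)
  qed
  show "T i X Y (Z + f *\<^sub>V \<xi>) p = T i X Y Z p + f p * T i X Y \<xi> p"
    by (rule r) (use assms in simp_all)
  show "T i X (Y + f *\<^sub>V \<xi>) Z p = T i X Y Z p + f p * T i X \<xi> Z p"
    using T_skew[of i X Z "Y + f *\<^sub>V \<xi>" p] T_skew[of i X Z Y p] T_skew[of i X Z \<xi> p] r[of Z Y] assms
    by simp
qed

text \<open>The projection onto H is written as -phi_1^2, a composition of endomorphism fields. The
  horizontal part is therefore a smooth field at once, and so is eta(X) xi, being the difference of
  two fields.\<close>

lemma horizontal_decomposition: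
  assumes "X \<in> V"
  obtains Y where "Y \<in> H" "X = Y + (\<lambda>p. \<eta> p (X p)) *\<^sub>V \<xi>" "(\<lambda>p. \<eta> p (X p)) *\<^sub>V \<xi> \<in> V"
proof -
  let ?Y = "- ap 1 (ap 1 X)"
  have "ap 1 (ap 1 X) \<in> H"
    using assms by (intro phi_H phi_field) simp_all
  then have Y: "?Y \<in> H" "?Y \<in> V"
    using eta_linear(1) field_tangent by (fastforce simp: H_def)+
  have X: "X = ?Y + (\<lambda>p. \<eta> p (X p)) *\<^sub>V \<xi>"
    using assms phi_phi[OF I_mem(1) field_tangent[OF assms]]
    by (simp add: vscale_def fun_eq_iff)
  have "X - ?Y \<in> V" using assms Y(2) by (rule field_closed(2))
  moreover have "X - ?Y = (\<lambda>p. \<eta> p (X p)) *\<^sub>V \<xi>" using X by (metis add_diff_cancel_left')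
  ultimately show thesis using that Y(1) X by metis
qed

section \<open>The Sasaki-Einstein equations\<close>

text \<open>d d eta = 0 with omega_3 = -(1/2) d eta. The second derivatives of eta cancel because
  the bracket acts as a commutator (\<open>om'\<close>), and what remains is eta applied to the
  Jacobi sum.\<close>

lemma d_omega3:
  assumes "X \<in> V" "Y \<in> V" "Z \<in> V"
  shows "ext_d2 (\<omega> 3) X Y Z p = 0"
proof -
  let ?a = "\<lambda>Y q. \<eta> q (Y q)"
  have om: "\<omega> 3 q (X q) (Y q) = - (1/2) * (X q (?a Y) - Y q (?a X) - \<eta> q (lie_bracket X Y q))"
    if "X \<in> V" "Y \<in> V" for X Y q
    using d_eta[OF that, of q] by (simp add: ext_d1_def)
  have D: "X p (\<lambda>q. \<omega> 3 q (Y q) (Z q)) = - (1/2) *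
      (X p (\<lambda>q. Y q (?a Z)) - X p (\<lambda>q. Z q (?a Y)) - X p (?a (lie_bracket Y Z)))"
    if "X \<in> V" "Y \<in> V" "Z \<in> V" for X Y Z
  proof -
    let ?f = "\<lambda>q. Y q (?a Z)" and ?h = "\<lambda>q. Z q (?a Y)" and ?k = "?a (lie_bracket Y Z)"
    have sm: "?f \<in> smooth_funs A" "?h \<in> smooth_funs A" "?k \<in> smooth_funs A"
      using that by (auto intro: vector_field_smooth smooth_eta)
    have sm': "(\<lambda>q. ?f q - ?h q) \<in> smooth_funs A"
      using smooth_funs_lincomb[OF mfd sm(1,2), of 1 "-1"] by simp
    have sm'': "(\<lambda>q. ?f q - ?h q - ?k q) \<in> smooth_funs A"
      using smooth_funs_lincomb[OF mfd sm' sm(3), of 1 "-1"] by simp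
    have "X p (\<lambda>q. \<omega> 3 q (Y q) (Z q)) = X p (\<lambda>q. - (1/2) * (?f q - ?h q - ?k q))"
      using om[OF that(2,3)] by simp
    also have "\<dots> = - (1/2) * X p (\<lambda>q. ?f q - ?h q - ?k q)"
      by (rule tangent_cmult[OF field_tangent[OF that(1)] sm''])
    also have "X p (\<lambda>q. ?f q - ?h q - ?k q) = X p ?f - X p ?h - X p ?k"
      by (simp only: tangent_diff[OF field_tangent[OF that(1)] sm' sm(3)]
          tangent_diff[OF field_tangent[OF that(1)] sm(1,2)])
    finally show ?thesis .
  qed
  have om': "\<omega> 3 p (lie_bracket X Y p) (Z p) = - (1/2) * (X p (\<lambda>q. Y q (?a Z)) - Y p (\<lambda>q. X q (?a Z))
      - Z p (?a (lie_bracket X Y)) - \<eta> p (lie_bracket (lie_bracket X Y) Z p))"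
    if "X \<in> V" "Y \<in> V" "Z \<in> V" for X Y Z
  proof -
    have "lie_bracket X Y p (?a Z) = X p (\<lambda>q. Y q (?a Z)) - Y p (\<lambda>q. X q (?a Z))"
      by (simp add: lie_bracket_def)
    then show ?thesis using om[OF bracket_field[OF that(1,2)] that(3), of p] by simp
  qed
  have br: "lie_bracket (lie_bracket X Y) Z p \<in> TM p" if "X \<in> V" "Y \<in> V" "Z \<in> V" for X Y Z
    using that by simp
  have "\<eta> p (lie_bracket (lie_bracket X Y) Z p - lie_bracket (lie_bracket X Z) Y p
      + lie_bracket (lie_bracket Y Z) X p) = 0"
    using lie_bracket_jacobi[OF assms, of p] eta_linear(2)[OF xi_tangent, of p 0]
      eta_linear(4)[OF xi_tangent xi_tangent, of p] by simp
  then have "\<eta> p (lie_bracket (lie_bracket X Y) Z p) - \<eta> p (lie_bracket (lie_bracket X Z) Y p)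
      + \<eta> p (lie_bracket (lie_bracket Y Z) X p) = 0"
    using br assms by (simp add: eta_linear)
  then show ?thesis
    using assms by (simp add: ext_d2_def D om' algebra_simps)
qed

lemma d_omega_horizontal:
  assumes "i \<in> I" "X \<in> H" "Y \<in> H" "Z \<in> H"
  shows "T i X Y Z p + T i Y Z X p + T i Z X Y p = 0"
proof -
  note V = assms(2-)[THEN H_D(1)]
  have "wedge12 \<eta> \<alpha> p (X p) (Y p) (Z p) = 0" for \<alpha>
    using assms(2-)[THEN H_D(2)] by (simp add: wedge12_def)
  then have "ext_d2 (\<omega> i) X Y Z p = 0"
    using assms(1) d_omega1[OF V, of p] d_omega2[OF V, of p] d_omega3[OF V, of p]
    by (auto simp: I_def)
  then show ?thesis using T_cyclic[OF assms(1) V] by simp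
qed

section \<open>Hitchin's lemma on the horizontal distribution\<close>

text \<open>Closedness of omega_i and omega_j on H gives the integrability condition Q = 0 for
  phi_k; together with closedness of omega_k this is the Kaehler condition, which makes phi_k
  parallel on H.\<close>

lemma T_horizontal:
  assumes "cyc i j k" "X \<in> H" "Y \<in> H" "Z \<in> H"
  shows "T k X Y Z p = 0"
proof -
  have I: "i \<in> I" "j \<in> I" "k \<in> I" using cyc_I[OF assms(1)] by auto
  have cyc: "cyc k i j" using assms(1) by (auto simp: cyc_def)
  let ?K = "ap k"
  have K: "?K X \<in> H" "ap i X \<in> H" if "X \<in> H" for X
    using that I by (auto intro: phi_H H_D(1))
  have KK: "?K (?K X) = - X" "ap i (ap i X) = - X" "ap i (?K X) = - ?K (ap i X)" if "X \<in> H" for X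
    using phi_phi_H[OF I(3) that] phi_phi_H[OF I(1) that]
      phi_mult[OF cyc field_tangent[OF H_D(1)[OF that]]]
    by (auto simp: fun_eq_iff)
  have j1: "T j X Y Z p = T k X (ap i Y) Z p - T i X Y (?K Z) p"
    and j2: "T j X Y Z p = T k X Y (ap i Z) p - T i X (?K Y) Z p"
    if "X \<in> H" "Y \<in> H" "Z \<in> H" for X Y Z
    using T_mult[OF cyc that[THEN H_D(1)], of p] by auto
  have neg: "T l (- X) Y Z p = - T l X Y Z p" "T l X (- Y) Z p = - T l X Y Z p"
    "T l X Y (- Z) p = - T l X Y Z p" if "l \<in> I" "X \<in> H" "Y \<in> H" "Z \<in> H" for l X Y Z
    using T_uminus[OF that(1) that(2-)[THEN H_D(1)]] .
  have skew: "T k X Z Y p = - T k X Y Z p" if "X \<in> H" "Y \<in> H" "Z \<in> H" for X Y Z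
    using T_skew[OF I(3) that[THEN H_D(1)]] .
  have shift: "T k X (?K Y) Z p = T k X Y (?K Z) p" if "X \<in> H" "Y \<in> H" "Z \<in> H" for X Y Z
    using T_phi[OF I(3) H_D(1)[OF that(1)] that(2,3)] .
  \<comment> \<open>With K = phi_k, this is g((nabla_{KX} K) Y - K (nabla_X K) Y, Z), the tensor
    whose vanishing expresses integrability of an almost Hermitian structure.\<close>
  define Q where "Q X Y Z = T k X Y (?K Z) p + T k (?K X) Y Z p" for X Y Z
  have Q_skew: "Q X Z Y = - Q X Y Z" if "X \<in> H" "Y \<in> H" "Z \<in> H" for X Y Z
    using that K skew[of X "?K Y" Z] skew[of "?K X" Y Z] shift[of X Y Z] by (simp add: Q_def)
  txt \<open>\<open>\<omega>\<^sub>i + \<i> \<omega>\<^sub>j\<close> is of type \<open>(2, 0)\<close> with respect to \<open>\<phi>\<^sub>k\<close>, so the vanishing of the real part of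
    its differential on \<open>Y + \<i> \<phi>\<^sub>k Y\<close>, \<open>Z + \<i> \<phi>\<^sub>k Z\<close>, \<open>W\<close> is the integrability of \<open>\<phi>\<^sub>k\<close>.\<close>
  have Q_sym: "Q Y Z U = Q Z Y U" if "Y \<in> H" "Z \<in> H" "U \<in> H" for Y Z U
  proof -
    \<comment> \<open>W is chosen so that phi_i W = -U: whenever W is in the second or third slot,
      \<open>j1\<close> or \<open>j2\<close> turns it into U in the T_k term and leaves it alone in
      the T_i term.\<close>
    define W where "W = ap i U"
    have W: "W \<in> H" "ap i W = - U" using that K KK by (auto simp: W_def)
    note H = that W(1) K(1)[OF that(1)] K(1)[OF that(2)] K(2)[OF that(1)]
    have 1: "T j Y (?K Z) W p = - T k Y (?K Z) U p + T i Y Z W p"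
      using j2[of Y "?K Z" W] H by (simp add: KK neg I W(2))
    have 2: "T j (?K Y) Z W p = - T k (?K Y) Z U p - T i (?K Y) (?K Z) W p"
      using j2[of "?K Y" Z W] H by (simp add: KK neg I W(2))
    have 3: "T j Z W (?K Y) p = - T k Z U (?K Y) p + T i Z W Y p"
      using j1[of Z W "?K Y"] H by (simp add: KK neg I W(2))
    have 4: "T j (?K Z) W Y p = - T k (?K Z) U Y p - T i (?K Z) W (?K Y) p"
      using j1[of "?K Z" W Y] H by (simp add: KK neg I W(2))
    have 5: "T j W Y (?K Z) p = T k W (ap i Y) (?K Z) p + T i W Y Z p"
      using j1[of W Y "?K Z"] H by (simp add: KK neg I)
    have 6: "T j W (?K Y) Z p = - T k W (ap i Y) (?K Z) p - T i W (?K Y) (?K Z) p"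
      using j1[of W "?K Y" Z] H K by (simp add: KK neg I shift)
    \<comment> \<open>In the sum of the two cyclic identities for T_j, the T_i terms form the cyclic
      sums of (Y, Z, W) and (K Y, K Z, W), which are zero. The T_k terms with W in the first slot,
      from 5 and 6, cancel each other.\<close>
    have "T k Y Z (?K U) p + T k (?K Y) Z U p + T k Z U (?K Y) p + T k (?K Z) U Y p = 0"
      using d_omega_horizontal[of i Y Z W p] d_omega_horizontal[of i "?K Y" "?K Z" W p]
        d_omega_horizontal[of j Y "?K Z" W p] d_omega_horizontal[of j "?K Y" Z W p]
        1 2 3 4 5 6 H I shift[OF that] by simp
    moreover have "T k Z U (?K Y) p = - T k Z Y (?K U) p"
      using skew[of Z "?K Y" U] shift[of Z Y U] H by simp
    moreover have "T k (?K Z) U Y p = - T k (?K Z) Y U p"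
      using skew[of "?K Z" Y U] H by simp
    ultimately show ?thesis by (simp add: Q_def)
  qed
  have Q0: "T k (?K X) Y Z p = - T k X Y (?K Z) p" if "X \<in> H" "Y \<in> H" "Z \<in> H" for X Y Z
  proof -
    \<comment> \<open>Alternating symmetry in the first two slots with skewness in the last two,
      three times each, returns to the initial order with sign -1.\<close>
    have "Q X Y Z = - Q X Y Z"
      using Q_sym[of X Y Z] Q_skew[of Y X Z] Q_sym[of Y Z X] Q_skew[of Z Y X] Q_sym[of Z X Y]
        Q_skew[of X Z Y] that by simp
    then show ?thesis by (simp add: Q_def)
  qed
  \<comment> \<open>In the sum of the cyclic identities for (X, K Y, Z) and (X, Y, K Z),
    \<open>Q0\<close> and \<open>shift\<close> cancel everything except twice this term.\<close>
  have "T k X Y (?K Z) p = 0" if "Z \<in> H" for Z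
    using d_omega_horizontal[of k X "?K Y" Z p] d_omega_horizontal[of k X Y "?K Z" p]
      Q0[of Y Z X] Q0[of Z X Y] shift[of Y Z X] shift[of X Y Z] K I assms that by simp
  from this[of "?K Z"] show ?thesis
    using assms K by (simp add: KK neg I)
qed

section \<open>The covariant derivative of xi\<close>

text \<open>As eta = g(., xi), B is the covariant derivative of eta, and its antisymmetrisation is d
  eta because the connection is torsion-free.\<close>

lemma B_skew:
  assumes "X \<in> V" "Y \<in> V"
  shows "B X Y p - B Y X p = - 2 * g p (\<phi> 3 p (X p)) (Y p)"
proof -
  have e: "X p (\<lambda>q. \<eta> q (Y q)) = g p (nabla X Y p) (\<xi> p) + B X Y p" if "X \<in> V" "Y \<in> V" for X Y
  proof -
    have "(\<lambda>q. \<eta> q (Y q)) = (\<lambda>q. g q (Y q) (\<xi> q))"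
      by (rule ext) (simp add: eta_g that)
    then show ?thesis
      using compat[OF that xi_field, of p] g_sym[of "Y p" p "nabla X \<xi> p"] that by (simp add: B_def)
  qed
  show ?thesis
    using d_eta[OF assms, of p] e[OF assms] e[OF assms(2,1)] assms
      eta_g[of "nabla X Y p" p] eta_g[of "nabla Y X p" p]
    by (simp add: ext_d1_def torsion_free eta_linear omega)
qed

text \<open>Unit length of xi gives the first claim. The second, that the integral curves of xi are
  geodesics, follows since the skew part of B kills xi.\<close>

lemma B_xi:
  assumes "X \<in> V"
  shows "B X \<xi> p = 0" "B \<xi> X p = 0"
proof -
  have one: "g q (\<xi> q) (\<xi> q) = 1" for q
    using eta_g[of "\<xi> q" q] eta_xi[of q] by simp
  \<comment> \<open>The constant 1 is smooth because it equals g(xi, xi).\<close>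
  have "(\<lambda>_. 1) \<in> smooth_funs A"
    using smooth_g[OF xi_field xi_field] by (simp add: one)
  then have "X p (\<lambda>q. g q (\<xi> q) (\<xi> q)) = 0"
    using tangent_one[OF field_tangent[OF assms]] by (simp add: one)
  then show *: "B X \<xi> p = 0"
    using compat[OF assms xi_field xi_field, of p] g_sym[of "\<xi> p" p "nabla X \<xi> p"] assms
    by (simp add: B_def)
  show "B \<xi> X p = 0"
    using B_skew[OF xi_field assms, of p] * assms by (simp add: phi_xi g_zero)
qed

lemma B_uminus:
  assumes "X \<in> V" "Y \<in> V"
  shows "B X (- Y) p = - B X Y p" "B (- X) Y p = - B X Y p"
  using assms by (simp_all add: B_def nabla_uminus g_linear)

text \<open>The cyclic sum is solved for the term with xi in the derivative slot; the other two have
  xi as an argument of omega_i and reduce to B.\<close>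

lemma T_xi_left:
  assumes "i \<in> I" "Y \<in> V" "Z \<in> V"
  shows "T i \<xi> Y Z p = B Y (ap i Z) p - B Z (ap i Y) p + ext_d2 (\<omega> i) \<xi> Y Z p"
  using T_cyclic[OF assms(1) xi_field assms(2,3), of p] T_skew[OF assms(1,2) xi_field assms(3), of p]
    T_xi[OF assms, of p] T_xi[OF assms(1,3,2), of p] by simp

lemma wedge_xi:
  assumes "Y \<in> H" "Z \<in> H"
  shows "wedge12 \<eta> \<alpha> p (\<xi> p) (Y p) (Z p) = \<alpha> p (Y p) (Z p)"
  using assms by (simp add: wedge12_def eta_xi H_D)

lemma g_phi_cyc:
  assumes "cyc i j k" "u \<in> TM p" "w \<in> TM p"
  shows "g p (\<phi> i p u) (\<phi> j p w) = g p (\<phi> k p u) w"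
    and "g p (\<phi> j p u) (\<phi> i p w) = - g p (\<phi> k p u) w"
  using g_phi[OF cyc_I(2)[OF assms(1)], of "\<phi> i p u" p w] g_phi[OF cyc_I(1)[OF assms(1)], of "\<phi> j p u" p w]
    phi_mult[OF assms(1,2)] assms cyc_I[OF assms(1)] by (simp_all add: g_linear)

text \<open>For i = 1, 2 the form d omega_i(xi, ., .) on H is a multiple of the other one of
  omega_1, omega_2, whose endomorphism anticommutes with phi_i; for i = 3 it is zero. Hence the d
  omega_i terms drop out when \<open>T_xi_left\<close> is compared with \<open>T_phi\<close>,
  leaving a condition on B alone.\<close>

lemma d_omega_xi_phi:
  assumes "i \<in> I" "Y \<in> H" "Z \<in> H"
  shows "ext_d2 (\<omega> i) \<xi> (ap i Y) Z p = ext_d2 (\<omega> i) \<xi> Y (ap i Z) p"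
proof -
  note V = assms(2,3)[THEN H_D(1)]
  note V' = phi_field[OF assms(1) V(1)] phi_field[OF assms(1) V(2)]
  note H' = phi_H[OF assms(1) V(1)] phi_H[OF assms(1) V(2)]
  have c: "cyc 1 2 3" by (simp add: cyc_def)
  have "i = 1 \<or> i = 2 \<or> i = 3" using assms(1) by (simp add: I_def)
  then show ?thesis
  proof (elim disjE)
    assume i: "i = 1"
    then show ?thesis
      using d_omega1[OF xi_field V'(1) V(2), of p] d_omega1[OF xi_field V(1) V'(2), of p]
        wedge_xi[OF H'(1) assms(3)] wedge_xi[OF assms(2) H'(2)] V
        g_phi_cyc(2)[OF c, of "Y p" p "Z p"] phi_mult(2)[OF c, of "Y p" p]
      by (simp add: omega g_linear)
  next
    assume i: "i = 2"
    then show ?thesis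
      using d_omega2[OF xi_field V'(1) V(2), of p] d_omega2[OF xi_field V(1) V'(2), of p]
        wedge_xi[OF H'(1) assms(3)] wedge_xi[OF assms(2) H'(2)] V
        g_phi_cyc(1)[OF c, of "Y p" p "Z p"] phi_mult(1)[OF c, of "Y p" p]
      by (simp add: omega)
  next
    assume "i = 3"
    then show ?thesis
      using d_omega3[OF xi_field V'(1) V(2), of p] d_omega3[OF xi_field V(1) V'(2), of p] by simp
  qed
qed

lemma B_eq:
  assumes "X \<in> V" "Y \<in> V"
  shows "B X Y p = - g p (\<phi> 3 p (X p)) (Y p)"
proof -
  define S where "S Y Z = B Y Z p + B Z Y p" for Y Z
  have S: "S (ap i Y) (ap i Z) = - S Y Z" if "i \<in> I" "Y \<in> H" "Z \<in> H" for i Y Z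
  proof -
    note V = that(2,3)[THEN H_D(1)]
    have "T i \<xi> (ap i Y) Z p = T i \<xi> Y (ap i Z) p"
      using T_phi[OF that(1) xi_field that(2,3)] .
    then show ?thesis
      using T_xi_left[OF that(1) phi_field[OF that(1) V(1)] V(2), of p]
        T_xi_left[OF that(1) V(1) phi_field[OF that(1) V(2)], of p]
        d_omega_xi_phi[OF that, of p] B_uminus[OF V, of p] B_uminus[OF V(2,1), of p]
        phi_phi_H[OF that(1,2)] phi_phi_H[OF that(1,3)]
      by (simp add: S_def)
  qed
  have S0: "S Y Z = 0" if "Y \<in> H" "Z \<in> H" for Y Z
  proof -
    have p: "ap 1 (ap 2 W) = ap 3 W" if "W \<in> H" for W
      using phi_mult(1)[of 1 2 3] that by (simp add: cyc_def H_D)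
    \<comment> \<open>Two sign changes give invariance under phi_1 phi_2, whereas this product is
      phi_3, under which S changes sign once.\<close>
    have "S (ap 1 (ap 2 Y)) (ap 1 (ap 2 Z)) = S Y Z"
      using S[of 1 "ap 2 Y" "ap 2 Z"] S[of 2 Y Z] that by (simp add: phi_H H_D)
    then show ?thesis using S[of 3 Y Z] that by (simp only: p I_mem)
  qed
  \<comment> \<open>Both sides vanish when either argument is xi, so the identity on H extends to
    all fields.\<close>
  obtain X' where X': "X' \<in> H" "X = X' + (\<lambda>p. \<eta> p (X p)) *\<^sub>V \<xi>" "(\<lambda>p. \<eta> p (X p)) *\<^sub>V \<xi> \<in> V"
    using horizontal_decomposition[OF assms(1)] .
  obtain Y' where Y': "Y' \<in> H" "Y = Y' + (\<lambda>p. \<eta> p (Y p)) *\<^sub>V \<xi>" "(\<lambda>p. \<eta> p (Y p)) *\<^sub>V \<xi> \<in> V"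
    using horizontal_decomposition[OF assms(2)] .
  note V = H_D(1)[OF X'(1)] H_D(1)[OF Y'(1)]
  have Xp: "X p = X' p + \<eta> p (X p) *\<^sub>T \<xi> p" and Yp: "Y p = Y' p + \<eta> p (Y p) *\<^sub>T \<xi> p"
    using fun_cong[OF X'(2), of p] fun_cong[OF Y'(2), of p] by (simp_all add: vscale_def)
  have "nabla X \<xi> = nabla X' \<xi> + (\<lambda>p. \<eta> p (X p)) *\<^sub>V nabla \<xi> \<xi>"
    using nabla_add_left[OF V(1) X'(3) xi_field] nabla_vscale[OF smooth_eta[OF assms(1)] xi_field xi_field]
      X'(2) by simp
  then have "nabla X \<xi> p = nabla X' \<xi> p + \<eta> p (X p) *\<^sub>T nabla \<xi> \<xi> p"
    by (simp add: vscale_def)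
  then have "B X Y p = B X' Y p + \<eta> p (X p) * B \<xi> Y p"
    using V assms by (simp add: B_def g_linear)
  moreover have "B X' Y p = B X' Y' p + \<eta> p (Y p) * B X' \<xi> p"
    using V by (subst (1) B_def, subst Yp) (simp add: B_def g_linear)
  ultimately have "B X Y p = B X' Y' p"
    using B_xi(1)[OF V(1)] B_xi(2)[OF assms(2)] by simp
  moreover have "B X' Y' p = - g p (\<phi> 3 p (X' p)) (Y' p)"
    using S0[OF X'(1) Y'(1)] B_skew[OF V, of p] by (simp add: S_def)
  moreover have "g p (\<phi> 3 p (X p)) (Y p) = g p (\<phi> 3 p (X' p)) (Y' p)"
  proof -
    have "g p (\<phi> 3 p (X p)) (Y p) = g p (\<phi> 3 p (X p)) (Y' p)"
      using eta_phi[of 3 "X p" p] V assms by (subst Yp) (simp add: g_linear eta_g)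
    also have "\<dots> = - g p (X p) (\<phi> 3 p (Y' p))"
      using V assms by (intro g_phi) simp_all
    also have "\<dots> = - g p (X' p) (\<phi> 3 p (Y' p))"
      using eta_phi[of 3 "Y' p" p] g_sym[of "\<xi> p" p "\<phi> 3 p (Y' p)"] V
      by (subst Xp) (simp add: g_linear eta_g)
    also have "\<dots> = g p (\<phi> 3 p (X' p)) (Y' p)"
      using V g_phi[of 3 "X' p" p "Y' p"] by simp
    finally show ?thesis .
  qed
  ultimately show ?thesis by simp
qed

section \<open>Total skewness of T_1 and T_2\<close>

text \<open>Common form of the two cases: (i, m, r) is (1, 2, 1) or (2, 1, -1), and r carries the
  sign both of d omega_i and of the quaternion product behind \<open>b\<close>.\<close>

lemma T_eq_wedge:
  assumes "i \<in> I" "m \<in> I" "X \<in> V" "Y \<in> V" "Z \<in> V"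
    and d: "\<And>X Y Z. X \<in> V \<Longrightarrow> Y \<in> V \<Longrightarrow> Z \<in> V \<Longrightarrow>
      ext_d2 (\<omega> i) X Y Z p = 3 * r * wedge12 \<eta> (\<omega> m) p (X p) (Y p) (Z p)"
    and b: "\<And>X Z. X \<in> V \<Longrightarrow> Z \<in> V \<Longrightarrow>
      g p (\<phi> 3 p (X p)) (\<phi> i p (Z p)) = r * \<omega> m p (X p) (Z p)"
  shows "T i X Y Z p = r * wedge12 \<eta> (\<omega> m) p (X p) (Y p) (Z p)"
proof -
  have sk: "\<omega> m p u w = - \<omega> m p w u" if "u \<in> TM p" "w \<in> TM p" for u w
    using g_phi_skew[OF assms(2) that] that by (simp add: omega assms(2))
  have xi: "\<omega> m p (u + s *\<^sub>T \<xi> p) w = \<omega> m p u w" "\<omega> m p w (u + s *\<^sub>T \<xi> p) = \<omega> m p w u"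
    if "u \<in> TM p" "w \<in> TM p" for u w s
  proof -
    show "\<omega> m p w (u + s *\<^sub>T \<xi> p) = \<omega> m p w u"
      using that assms(2) eta_phi[OF assms(2) that(2)] by (simp add: omega g_linear eta_g)
    then show "\<omega> m p (u + s *\<^sub>T \<xi> p) w = \<omega> m p u w"
      using sk[of "u + s *\<^sub>T \<xi> p" w] sk[of u w] that by simp
  qed
  have B: "B X (ap i Z) p = - r * \<omega> m p (X p) (Z p)" if "X \<in> V" "Z \<in> V" for X Z
    using B_eq[of X "ap i Z" p] b[OF that] that assms(1) by simp
  have T1: "T i X \<xi> Z p = - r * \<omega> m p (X p) (Z p)" if "X \<in> V" "Z \<in> V" for X Z
    using T_xi[OF assms(1) that] B[OF that] by simp
  \<comment> \<open>The B terms contribute -2 r omega_m and d omega_i contributes 3 r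
    omega_m.\<close>
  have T2: "T i \<xi> Y Z p = r * \<omega> m p (Y p) (Z p)" if "Y \<in> H" "Z \<in> H" for Y Z
    using T_xi_left[OF assms(1) H_D(1)[OF that(1)] H_D(1)[OF that(2)], of p] that
      d[OF xi_field, of Y Z] wedge_xi[OF that] sk[of "Z p" "Y p"] by (simp add: B H_D algebra_simps)
  obtain X' where X': "X' \<in> H" "X = X' + (\<lambda>p. \<eta> p (X p)) *\<^sub>V \<xi>" "(\<lambda>p. \<eta> p (X p)) *\<^sub>V \<xi> \<in> V"
    using horizontal_decomposition[OF assms(3)] .
  obtain Y' where Y': "Y' \<in> H" "Y = Y' + (\<lambda>p. \<eta> p (Y p)) *\<^sub>V \<xi>" "(\<lambda>p. \<eta> p (Y p)) *\<^sub>V \<xi> \<in> V"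
    using horizontal_decomposition[OF assms(4)] .
  obtain Z' where Z': "Z' \<in> H" "Z = Z' + (\<lambda>p. \<eta> p (Z p)) *\<^sub>V \<xi>" "(\<lambda>p. \<eta> p (Z p)) *\<^sub>V \<xi> \<in> V"
    using horizontal_decomposition[OF assms(5)] .
  note V = X'(1)[THEN H_D(1)] Y'(1)[THEN H_D(1)] Z'(1)[THEN H_D(1)]
  have Yp: "Y p = Y' p + \<eta> p (Y p) *\<^sub>T \<xi> p" and Zp: "Z p = Z' p + \<eta> p (Z p) *\<^sub>T \<xi> p"
    using fun_cong[OF Y'(2), of p] fun_cong[OF Z'(2), of p] by (simp_all add: vscale_def)
  have "\<exists>j k. cyc j k i" using assms(1) by (auto simp: I_def cyc_def)
  then have T0: "T i X' Y' Z' p = 0" using T_horizontal X'(1) Y'(1) Z'(1) by blast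
  \<comment> \<open>The xi-components are split off from Z, then Y, then X. Each split yields one
    term of the wedge product, and the horizontal remainder is zero by \<open>T0\<close>; since
    omega_m kills xi, primed arguments may be replaced by the original ones.\<close>
  have "T i X Y Z p = T i X Y Z' p + \<eta> p (Z p) * T i X Y \<xi> p"
    using T_add(2)[OF assms(1,3,4) V(3) smooth_eta[OF assms(5)] Z'(3), of p] Z'(2) by simp
  moreover have "T i X Y Z' p = T i X Y' Z' p + \<eta> p (Y p) * T i X \<xi> Z' p"
    using T_add(3)[OF assms(1,3) V(2,3) smooth_eta[OF assms(4)] Y'(3), of p] Y'(2) by simp
  moreover have "T i X Y' Z' p = T i X' Y' Z' p + \<eta> p (X p) * T i \<xi> Y' Z' p"
    using T_add(1)[OF assms(1) V smooth_eta[OF assms(3)] X'(3), of p] X'(2) by simp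
  moreover have "T i X Y \<xi> p = r * \<omega> m p (X p) (Y p)"
    using T_skew[OF assms(1,3) xi_field assms(4), of p] T1[OF assms(3,4)] by simp
  moreover have "T i X \<xi> Z' p = - r * \<omega> m p (X p) (Z p)"
    using T1[OF assms(3) V(3)] xi(2)[of "Z' p" "X p" "\<eta> p (Z p)"] V assms(3) Zp by simp
  moreover have "T i \<xi> Y' Z' p = r * \<omega> m p (Y p) (Z p)"
    using T2[OF Y'(1) Z'(1)] xi(1)[of "Y' p" "Z p" "\<eta> p (Y p)"] xi(2)[of "Z' p" "Y' p" "\<eta> p (Z p)"]
      V assms(5) Yp Zp by simp
  ultimately show ?thesis by (simp add: T0 wedge12_def algebra_simps)
qed

lemma nearly_cosymplectic_12:
  fixes r :: real and i m :: nat
  assumes "i = 1 \<and> m = 2 \<and> r = 1 \<or> i = 2 \<and> m = 1 \<and> r = - 1"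
  shows "nearly_cosymplectic A nabla (\<phi> i) \<xi> \<eta> g"
proof -
  have I: "i \<in> I" "m \<in> I" using assms by auto
  have c: "cyc 3 1 2" "cyc 2 3 1" by (simp_all add: cyc_def)
  have T: "T i X Y Z p = r * wedge12 \<eta> (\<omega> m) p (X p) (Y p) (Z p)" if "X \<in> V" "Y \<in> V" "Z \<in> V" for X Y Z p
  proof (rule T_eq_wedge[OF I that])
    show "ext_d2 (\<omega> i) X Y Z p = 3 * r * wedge12 \<eta> (\<omega> m) p (X p) (Y p) (Z p)"
      if "X \<in> V" "Y \<in> V" "Z \<in> V" for X Y Z
      using assms d_omega1[OF that, of p] d_omega2[OF that, of p] by auto
    show "g p (\<phi> 3 p (X p)) (\<phi> i p (Z p)) = r * \<omega> m p (X p) (Z p)" if "X \<in> V" "Z \<in> V" for X Z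
      using assms that g_phi_cyc(1)[OF c(1), of "X p" p "Z p"] g_phi_cyc(2)[OF c(2), of "X p" p "Z p"]
      by (auto simp: omega)
  qed
  have "nabla_endo nabla X (\<phi> i) Y + nabla_endo nabla Y (\<phi> i) X = 0" (is "?U = 0")
    if "X \<in> V" "Y \<in> V" for X Y
  proof
    fix p
    have U: "?U \<in> V" using that I by simp
    have "\<omega> m p (X p) (Y p) = - \<omega> m p (Y p) (X p)"
      using g_phi_skew[OF I(2), of "X p" p "Y p"] that by (simp add: omega I)
    then have "T i X Y ?U p + T i Y X ?U p = 0"
      using T[OF that U, of p] T[OF that(2,1) U, of p] by (simp add: wedge12_def algebra_simps)
    \<comment> \<open>The sum is tested against itself: skewness of T_i in its first two slots makes
      its squared length zero.\<close>
    moreover have "g p (?U p) (?U p) = T i X Y ?U p + T i Y X ?U p"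
      unfolding T_def by (subst g_linear(3)[symmetric]) (use that I U field_tangent in simp_all)
    ultimately have "?U p = 0"
      using g_nondegenerate[OF field_tangent[OF U]] by simp
    then show "?U p = 0 p" by simp
  qed
  then show ?thesis
    using acm[OF I(1)] lc unfolding nearly_cosymplectic_def by blast
qed

end

theorem corollary5p2:
  fixes A :: "('a::{t2_space, second_countable_topology}, 5) atlas"
    and \<eta> :: "'a form1" and \<omega> :: "nat \<Rightarrow> 'a form2"
    and \<phi> :: "nat \<Rightarrow> 'a endo" and \<xi> :: "'a vfield" and g :: "'a form2"
    and nabla :: "'a connection"
  assumes "smooth_manifold A" and "connected (UNIV :: 'a set)"
    and "su2_forms A \<eta> \<omega>"
    and "su2_acms A \<phi> \<xi> \<eta> g"
    and "\<forall>i\<in>{1, 2, 3}. \<forall>p. \<forall>u\<in>tangent_space A p. \<forall>w\<in>tangent_space A p.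
           \<omega> i p u w = g p (\<phi> i p u) w"
    and "levi_civita A g nabla"
    and "\<forall>X\<in>vector_fields A. \<forall>Y\<in>vector_fields A. \<forall>p.
           ext_d1 \<eta> X Y p = - 2 * \<omega> 3 p (X p) (Y p)"
    and "\<forall>X\<in>vector_fields A. \<forall>Y\<in>vector_fields A. \<forall>Z\<in>vector_fields A. \<forall>p.
           ext_d2 (\<omega> 1) X Y Z p = 3 * wedge12 \<eta> (\<omega> 2) p (X p) (Y p) (Z p)"
    and "\<forall>X\<in>vector_fields A. \<forall>Y\<in>vector_fields A. \<forall>Z\<in>vector_fields A. \<forall>p.
           ext_d2 (\<omega> 2) X Y Z p = - 3 * wedge12 \<eta> (\<omega> 1) p (X p) (Y p) (Z p)"
  shows "\<forall>i\<in>{1, 2}. nearly_cosymplectic A nabla (\<phi> i) \<xi> \<eta> g"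
proof -
  interpret sasaki_einstein A \<eta> \<omega> \<phi> \<xi> g nabla
  proof
    show "two_form A (\<omega> i)" if "i \<in> I" for i
      using assms(3) that unfolding su2_forms_def I_def by blast
    show "\<omega> i p u w = g p (\<phi> i p u) w"
      if "i \<in> I" "u \<in> tangent_space A p" "w \<in> tangent_space A p" for i u w p
      using assms(5) that unfolding I_def by blast
  qed (use assms in blast)+
  show ?thesis
    using nearly_cosymplectic_12[of 1 2 1] nearly_cosymplectic_12[of 2 1 "- 1"] by blast
qed

end
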